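(* Let $L:\mathcal{D}\to\mathcal{E}$ and $R:\mathcal{E}\to\mathcal{D}$ form a Galois correspondence $(L,R)$ between topological categories $\mathcal{D}$ and $\mathcal{E}$ over a category $\mathcal{B}$. A topological category $\mathcal{X}$ over $\mathcal{B}$ is concretely equivalent to $\mathsf{Fix}(RL)$ if, and only if, there exist (concrete categories $\mathcal{A}$, $\mathcal{C}$ over $\mathcal{B}$ and) finally dense concrete functors $F:\mathcal{A}\to\mathcal{X}$, $K:\mathcal{A}\to\mathcal{D}$ and initially dense concrete functors $G:\mathcal{C}\to\mathcal{X}$, $H:\mathcal{C}\to\mathcal{E}$ with $$\mathcal{E}(LKA,HC)=\mathcal{X}(FA,GC)\quad\text{for all }A\in\mathcal{A}_0,\ C\in\mathcal{C}_0.$$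
   Context: Concrete categories. A concrete category $\mathcal{E}$ over $\mathcal{B}$ (a faithful functor $|\text{-}|:\mathcal{E}\to\mathcal{B}$, with $\mathcal{E}(X,Y)$ identified with its image; $\mathcal{B}$ locally small, classes of objects possibly large) is given by a class $\mathcal{E}_0$ of objects, a function $|\text{-}|:\mathcal{E}_0\to\mathcal{B}_0$, and subsets $\mathcal{E}(X,Y)\subseteq\mathcal{B}(|X|,|Y|)$ with $1_{|X|}\in\mathcal{E}(X,X)$ and $\mathcal{E}(Y,Z)\circ\mathcal{E}(X,Y)\subseteq\mathcal{E}(X,Z)$. A map $f\in\mathcal{B}(|X|,|Y|)$ is an $\mathcal{E}$-morphism if $f\in\mathcal{E}(X,Y)$. A concrete functor $F:\mathcal{D}\to\mathcal{E}$ is a function $F:\mathcal{D}_0\to\mathcal{E}_0$ with $|FX|=|X|$ and $\mathcal{D}(X,Y)\subseteq\mathcal{E}(FX,FY)$. The hom-sets in the displayed equation are compared as subsets of $\mathcal{B}(|A|,|C|)$. Order and $\cong$. In a concrete category $\mathcal{E}$, $X\le Y$ means $|X|=|Y|$ and $1_{|X|}\in\mathcal{E}(X,Y)$; $X\cong Y$ means $X\le Y$ and $Y\le X$ (stronger than isomorphism in the ordinary sense). Concrete functors are ordered pointwise, and $F\cong G$ means $FX\cong GX$ for all $X$. Concrete functors $L:\mathcal{D}\to\mathcal{E}$ and $R:\mathcal{E}\to\mathcal{D}$ form a Galois correspondence $(L,R)$ if $1_{\mathcal{D}}\le RL$ and $LR\le 1_{\mathcal{E}}$; equivalently $\mathcal{E}(LX,Y)=\mathcal{D}(X,RY)$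 for all $X\in\mathcal{D}_0$, $Y\in\mathcal{E}_0$. $\mathsf{Fix}(RL)$ is the full subcategory of $\mathcal{D}$ whose objects are those $X\in\mathcal{D}_0$ with $RLX\cong X$. Concrete categories $\mathcal{X},\mathcal{Y}$ are concretely equivalent if there are concrete functors $P:\mathcal{X}\to\mathcal{Y}$, $P':\mathcal{Y}\to\mathcal{X}$ with $1_{\mathcal{X}}\cong P'P$ and $PP'\cong 1_{\mathcal{Y}}$. Initial sources and final sinks. A (possibly large) family of $\mathcal{E}$-morphisms $(g_i:Y\to X_i)_{i\in I}$ is an initial source if for any $Z\in\mathcal{E}_0$, a map $f:|Z|\to|Y|$ is an $\mathcal{E}$-morphism as soon as all $g_i\circ f$ are $\mathcal{E}$-morphisms $Z\to X_i$. A family of $\mathcal{E}$-morphisms $(f_i:X_i\to Y)_{i\in I}$ is a final sink if for any $Z\in\mathcal{E}_0$, a map $g:|Y|\to|Z|$ is an $\mathcal{E}$-morphism as soon as all $g\circ f_i$ are $\mathcal{E}$-morphisms $X_i\to Z$. A concrete functor $F:\mathcal{D}\to\mathcal{E}$ is initially dense (resp. finally dense) if every $Y\in\mathcal{E}_0$ is the domain (resp. codomain) of some initial source $(g_i:Y\to FX_i)_{i\in I}$ (resp. final sink $(f_i:FX_i\to Y)_{i\in I}$) in $\mathcal{E}$ with $X_i\in\mathcal{D}_0$ for all $i\in I$. Topological categories. $\mathcal{E}$ is topological over $\mathcal{B}$ if every $\mathcal{E}$-structured source, i.e. every (possibly large) family of maps $(g_i:T\to|X_i|)_{i\in I}$ in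 $\mathcal{B}$ with $T\in\mathcal{B}_0$ and $X_i\in\mathcal{E}_0$, has an initial lifting, i.e. an object $Y\in\mathcal{E}_0$ with $|Y|=T$ such that $(g_i:Y\to X_i)_{i\in I}$ is an initial source in $\mathcal{E}$. Equivalently, every $\mathcal{E}$-structured sink $(f_i:|X_i|\to T)_{i\in I}$ has a final lifting (defined dually). *)

theory Defs
  imports Main
begin

section \<open>Categories\<close>

text \<open>
  Hom-sets of a category are recovered from source and target, so they are pairwise disjoint and
  composition needs no object arguments.
\<close>

record ('b, 'm) category =
  Ob  :: "'b set"
  Ar  :: "'m set"
  Src :: "'m \<Rightarrow> 'b"
  Tgt :: "'m \<Rightarrow> 'b"
  Idt :: "'b \<Rightarrow> 'm"
  Cmp :: "'m \<Rightarrow> 'm \<Rightarrow> 'm"  (infixr "\<cdot>\<index>" 70)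

definition Hom :: "('b, 'm) category \<Rightarrow> 'b \<Rightarrow> 'b \<Rightarrow> 'm set" where
  "Hom B S T = {f \<in> Ar B. Src B f = S \<and> Tgt B f = T}"

locale category =
  fixes B :: "('b, 'm) category" (structure)
  assumes Src_Ob: "f \<in> Ar B \<Longrightarrow> Src B f \<in> Ob B"
    and Tgt_Ob: "f \<in> Ar B \<Longrightarrow> Tgt B f \<in> Ob B"
    and Idt_Hom: "S \<in> Ob B \<Longrightarrow> Idt B S \<in> Hom B S S"
    and Cmp_Hom: "\<lbrakk>f \<in> Hom B S T; g \<in> Hom B T U\<rbrakk> \<Longrightarrow> g \<cdot> f \<in> Hom B S U"
    and Cmp_Idt: "f \<in> Hom B S T \<Longrightarrow> f \<cdot> Idt B S = f"
    and Idt_Cmp: "f \<in> Hom B S T \<Longrightarrow> Idt B T \<cdot> f = f"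
    and Cmp_assoc: "\<lbrakk>f \<in> Hom B S T; g \<in> Hom B T U; h \<in> Hom B U V\<rbrakk>
      \<Longrightarrow> (h \<cdot> g) \<cdot> f = h \<cdot> (g \<cdot> f)"

section \<open>Concrete categories and concrete functors\<close>

text \<open>
  \<open>und E X\<close> is the underlying object \<open>|X|\<close>, and \<open>mor E X Y\<close> is the set \<open>E(X,Y)\<close> of those
  base maps \<open>|X| \<rightarrow> |Y|\<close> that are \<open>E\<close>-morphisms. Values at arguments outside \<open>obj E\<close> are irrelevant.
\<close>

record ('o, 'b, 'm) concrete =
  obj :: "'o set"
  und :: "'o \<Rightarrow> 'b"
  mor :: "'o \<Rightarrow> 'o \<Rightarrow> 'm set"

locale concrete_category = category B
  for B :: "('b, 'm) category" (structure) +
  fixes E :: "('o, 'b, 'm) concrete"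
  assumes und_Ob: "X \<in> obj E \<Longrightarrow> und E X \<in> Ob B"
    and mor_Hom: "\<lbrakk>X \<in> obj E; Y \<in> obj E\<rbrakk> \<Longrightarrow> mor E X Y \<subseteq> Hom B (und E X) (und E Y)"
    and mor_Idt: "X \<in> obj E \<Longrightarrow> Idt B (und E X) \<in> mor E X X"
    and mor_Cmp: "\<lbrakk>X \<in> obj E; Y \<in> obj E; Z \<in> obj E; f \<in> mor E X Y; g \<in> mor E Y Z\<rbrakk>
      \<Longrightarrow> g \<cdot> f \<in> mor E X Z"

definition concrete_functor ::
  "('o, 'b, 'm) concrete \<Rightarrow> ('p, 'b, 'm) concrete \<Rightarrow> ('o \<Rightarrow> 'p) \<Rightarrow> bool" where
  "concrete_functor D E F \<longleftrightarrow>
     (\<forall>X\<in>obj D. F X \<in> obj E \<and> und E (F X) = und D X) \<and>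
     (\<forall>X\<in>obj D. \<forall>Y\<in>obj D. mor D X Y \<subseteq> mor E (F X) (F Y))"

definition obj_le :: "('b, 'm) category \<Rightarrow> ('o, 'b, 'm) concrete \<Rightarrow> 'o \<Rightarrow> 'o \<Rightarrow> bool" where
  "obj_le B E X Y \<longleftrightarrow> und E X = und E Y \<and> Idt B (und E X) \<in> mor E X Y"

definition obj_cong :: "('b, 'm) category \<Rightarrow> ('o, 'b, 'm) concrete \<Rightarrow> 'o \<Rightarrow> 'o \<Rightarrow> bool" where
  "obj_cong B E X Y \<longleftrightarrow> obj_le B E X Y \<and> obj_le B E Y X"

definition functor_le :: "('b, 'm) category \<Rightarrow> ('o, 'b, 'm) concrete \<Rightarrow> ('p, 'b, 'm) concrete \<Rightarrow>
    ('o \<Rightarrow> 'p) \<Rightarrow> ('o \<Rightarrow> 'p) \<Rightarrow> bool" where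
  "functor_le B D E F G \<longleftrightarrow> (\<forall>X\<in>obj D. obj_le B E (F X) (G X))"

definition functor_cong :: "('b, 'm) category \<Rightarrow> ('o, 'b, 'm) concrete \<Rightarrow> ('p, 'b, 'm) concrete \<Rightarrow>
    ('o \<Rightarrow> 'p) \<Rightarrow> ('o \<Rightarrow> 'p) \<Rightarrow> bool" where
  "functor_cong B D E F G \<longleftrightarrow> (\<forall>X\<in>obj D. obj_cong B E (F X) (G X))"

definition galois_correspondence :: "('b, 'm) category \<Rightarrow> ('d, 'b, 'm) concrete \<Rightarrow>
    ('e, 'b, 'm) concrete \<Rightarrow> ('d \<Rightarrow> 'e) \<Rightarrow> ('e \<Rightarrow> 'd) \<Rightarrow> bool" where
  "galois_correspondence B D E L R \<longleftrightarrow>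
     concrete_functor D E L \<and> concrete_functor E D R \<and>
     functor_le B D D id (R \<circ> L) \<and> functor_le B E E (L \<circ> R) id"

definition Fix :: "('b, 'm) category \<Rightarrow> ('o, 'b, 'm) concrete \<Rightarrow> ('o \<Rightarrow> 'o) \<Rightarrow>
    ('o, 'b, 'm) concrete" where
  "Fix B D T = D\<lparr>obj := {X \<in> obj D. obj_cong B D (T X) X}\<rparr>"

definition concretely_equivalent :: "('b, 'm) category \<Rightarrow> ('o, 'b, 'm) concrete \<Rightarrow>
    ('p, 'b, 'm) concrete \<Rightarrow> bool" where
  "concretely_equivalent B X Y \<longleftrightarrow>
     (\<exists>P P'. concrete_functor X Y P \<and> concrete_functor Y X P' \<and>
        functor_cong B X X id (P' \<circ> P) \<and> functor_cong B Y Y (P \<circ> P') id)"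

section \<open>Initial sources and final sinks\<close>

definition initial_source :: "('b, 'm) category \<Rightarrow> ('o, 'b, 'm) concrete \<Rightarrow>
    'o \<Rightarrow> 'i set \<Rightarrow> ('i \<Rightarrow> 'o) \<Rightarrow> ('i \<Rightarrow> 'm) \<Rightarrow> bool" where
  "initial_source B E Y I X g \<longleftrightarrow>
     Y \<in> obj E \<and> (\<forall>i\<in>I. X i \<in> obj E \<and> g i \<in> mor E Y (X i)) \<and>
     (\<forall>Z\<in>obj E. \<forall>f\<in>Hom B (und E Z) (und E Y).
        (\<forall>i\<in>I. g i \<cdot>\<^bsub>B\<^esub> f \<in> mor E Z (X i)) \<longrightarrow> f \<in> mor E Z Y)"

definition final_sink :: "('b, 'm) category \<Rightarrow> ('o, 'b, 'm) concrete \<Rightarrow>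
    'o \<Rightarrow> 'i set \<Rightarrow> ('i \<Rightarrow> 'o) \<Rightarrow> ('i \<Rightarrow> 'm) \<Rightarrow> bool" where
  "final_sink B E Y I X f \<longleftrightarrow>
     Y \<in> obj E \<and> (\<forall>i\<in>I. X i \<in> obj E \<and> f i \<in> mor E (X i) Y) \<and>
     (\<forall>Z\<in>obj E. \<forall>g\<in>Hom B (und E Y) (und E Z).
        (\<forall>i\<in>I. g \<cdot>\<^bsub>B\<^esub> f i \<in> mor E (X i) Z) \<longrightarrow> g \<in> mor E Y Z)"

text \<open>
  A definition cannot quantify over all index types. Initiality and finality depend only on the set
  of pairs consisting of an object and a map occurring in the family, so it suffices
  that families are indexed by sets of such pairs, which may be as large as the class of all
  pairs. The lemmas at the end of this section show that nothing is lost for other index types.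
\<close>

definition initially_dense :: "('b, 'm) category \<Rightarrow> ('o, 'b, 'm) concrete \<Rightarrow>
    ('p, 'b, 'm) concrete \<Rightarrow> ('o \<Rightarrow> 'p) \<Rightarrow> bool" where
  "initially_dense B D E F \<longleftrightarrow>
     (\<forall>Y\<in>obj E. \<exists>(I :: ('o \<times> 'm) set) X g.
        (\<forall>i\<in>I. X i \<in> obj D) \<and> initial_source B E Y I (\<lambda>i. F (X i)) g)"

definition finally_dense :: "('b, 'm) category \<Rightarrow> ('o, 'b, 'm) concrete \<Rightarrow>
    ('p, 'b, 'm) concrete \<Rightarrow> ('o \<Rightarrow> 'p) \<Rightarrow> bool" where
  "finally_dense B D E F \<longleftrightarrow>
     (\<forall>Y\<in>obj E. \<exists>(I :: ('o \<times> 'm) set) X f.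
        (\<forall>i\<in>I. X i \<in> obj D) \<and> final_sink B E Y I (\<lambda>i. F (X i)) f)"

locale topological_category = concrete_category B E
  for B :: "('b, 'm) category" (structure) and E :: "('o, 'b, 'm) concrete" +
  assumes initial_lifting:
    "\<And>T (I :: ('o \<times> 'm) set) X g.
       \<lbrakk>T \<in> Ob B; \<forall>i\<in>I. X i \<in> obj E \<and> g i \<in> Hom B T (und E (X i))\<rbrakk>
       \<Longrightarrow> \<exists>Y. und E Y = T \<and> initial_source B E Y I X g"

lemma initial_source_reindex:
  "initial_source B E Y ((\<lambda>i. (X i, g i)) ` I) (\<lambda>p. F (fst p)) snd \<longleftrightarrow>
   initial_source B E Y I (\<lambda>i. F (X i)) g"
  by (simp add: initial_source_def)

lemma final_sink_reindex:
  "final_sink B E Y ((\<lambda>i. (X i, f i)) ` I) (\<lambda>p. F (fst p)) snd \<longleftrightarrow>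
   final_sink B E Y I (\<lambda>i. F (X i)) f"
  by (simp add: final_sink_def)

lemma (in topological_category) initial_lifting_any_index:
  fixes I :: "'i set"
  assumes "T \<in> Ob B" and "\<forall>i\<in>I. X i \<in> obj E \<and> g i \<in> Hom B T (und E (X i))"
  shows "\<exists>Y. und E Y = T \<and> initial_source B E Y I X g"
proof -
  have "\<exists>Y. und E Y = T \<and> initial_source B E Y ((\<lambda>i. (X i, g i)) ` I) fst snd"
    by (rule initial_lifting) (use assms in auto)
  then show ?thesis
    by (simp only: initial_source_reindex[where F = "\<lambda>x. x"])
qed

lemma initially_denseI_any_index:
  fixes D :: "('o, 'b, 'm) concrete"
  assumes "\<And>Y. Y \<in> obj E \<Longrightarrow> \<exists>(I :: 'i set) X g.
    (\<forall>i\<in>I. X i \<in> obj D) \<and> initial_source B E Y I (\<lambda>i. F (X i)) g"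
  shows "initially_dense B D E F"
  unfolding initially_dense_def
proof
  fix Y assume "Y \<in> obj E"
  then obtain I :: "'i set" and X g where
    X: "\<forall>i\<in>I. X i \<in> obj D" and g: "initial_source B E Y I (\<lambda>i. F (X i)) g"
    using assms by blast
  have "initial_source B E Y ((\<lambda>i. (X i, g i)) ` I) (\<lambda>p. F (fst p)) snd"
    using g by (simp add: initial_source_reindex)
  moreover have "\<forall>p\<in>(\<lambda>i. (X i, g i)) ` I. fst p \<in> obj D"
    using X by auto
  ultimately show "\<exists>(I :: ('o \<times> 'm) set) X g. (\<forall>i\<in>I. X i \<in> obj D) \<and> initial_source B E Y I (\<lambda>i. F (X i)) g"
    by - (rule exI[of _ "(\<lambda>i. (X i, g i)) ` I"], rule exI[of _ fst], rule exI[of _ snd], rule conjI)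
qed

lemma finally_denseI_any_index:
  fixes D :: "('o, 'b, 'm) concrete"
  assumes "\<And>Y. Y \<in> obj E \<Longrightarrow> \<exists>(I :: 'i set) X f.
    (\<forall>i\<in>I. X i \<in> obj D) \<and> final_sink B E Y I (\<lambda>i. F (X i)) f"
  shows "finally_dense B D E F"
  unfolding finally_dense_def
proof
  fix Y assume "Y \<in> obj E"
  then obtain I :: "'i set" and X f where
    X: "\<forall>i\<in>I. X i \<in> obj D" and f: "final_sink B E Y I (\<lambda>i. F (X i)) f"
    using assms by blast
  have "final_sink B E Y ((\<lambda>i. (X i, f i)) ` I) (\<lambda>p. F (fst p)) snd"
    using f by (simp add: final_sink_reindex)
  moreover have "\<forall>p\<in>(\<lambda>i. (X i, f i)) ` I. fst p \<in> obj D"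
    using X by auto
  ultimately show "\<exists>(I :: ('o \<times> 'm) set) X f. (\<forall>i\<in>I. X i \<in> obj D) \<and> final_sink B E Y I (\<lambda>i. F (X i)) f"
    by - (rule exI[of _ "(\<lambda>i. (X i, f i)) ` I"], rule exI[of _ fst], rule exI[of _ snd], rule conjI)
qed

section \<open>Dense data linking a concrete category to a Galois correspondence\<close>

definition dense_data :: "('b, 'm) category \<Rightarrow> ('d, 'b, 'm) concrete \<Rightarrow> ('e, 'b, 'm) concrete \<Rightarrow>
    ('d \<Rightarrow> 'e) \<Rightarrow> ('x, 'b, 'm) concrete \<Rightarrow> ('a, 'b, 'm) concrete \<Rightarrow> ('c, 'b, 'm) concrete \<Rightarrow>
    ('a \<Rightarrow> 'x) \<Rightarrow> ('a \<Rightarrow> 'd) \<Rightarrow> ('c \<Rightarrow> 'x) \<Rightarrow> ('c \<Rightarrow> 'e) \<Rightarrow> bool" where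
  "dense_data B D E L X A C F K G H \<longleftrightarrow>
     concrete_category B A \<and> concrete_category B C \<and>
     concrete_functor A X F \<and> finally_dense B A X F \<and>
     concrete_functor A D K \<and> finally_dense B A D K \<and>
     concrete_functor C X G \<and> initially_dense B C X G \<and>
     concrete_functor C E H \<and> initially_dense B C E H \<and>
     (\<forall>a\<in>obj A. \<forall>c\<in>obj C. mor E (L (K a)) (H c) = mor X (F a) (G c))"

end

theory Submission
  imports Defs
begin

text \<open>
  Both directions rest on the adjunction formula \<open>E(LY,Z) = D(Y,RZ)\<close>, and on the fact that every
  object \<open>RZ\<close> lies in \<open>Fix(RL)\<close>.

  If \<open>P\<close> and \<open>P'\<close> form an equivalence between \<open>X\<close> and \<open>Fix(RL)\<close>, take \<open>A = D\<close> and \<open>C = E\<close> with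
  \<open>K\<close> and \<open>H\<close> the identities, \<open>F = P'RL\<close> and \<open>G = P'R\<close>. As \<open>P'\<close> is full, the displayed equation of
  hom-sets amounts to \<open>E(LA,C) = D(RLA,RC)\<close>. Every object \<open>x\<close> of \<open>X\<close> is, up to \<open>\<cong>\<close>, a value of \<open>F\<close>
  and of \<open>G\<close>, so an identity map alone is the required final sink or initial source.

  For the converse, final density says that an object of \<open>X\<close> or \<open>D\<close> is known from the maps into it
  out of the objects \<open>FA\<close> or \<open>KA\<close>, its probes. Call \<open>x\<close> in \<open>X\<close> and \<open>Y\<close> in \<open>D\<close> \<^emph>\<open>matching\<close> if they
  have the same underlying object and the same probes, \<open>X(FA,x) = D(KA,Y)\<close> for all \<open>A\<close>. Matching
  pairs \<open>(x,Y)\<close>, \<open>(x',Y')\<close> satisfy \<open>X(x,x') = D(Y,Y')\<close> (\<open>mor_eq_if_matching\<close>). Therefore it suffices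
  that each object of \<open>X\<close> matches one of \<open>Fix(RL)\<close> and conversely: any choice of partners is then
  a pair of mutually inverse concrete functors up to \<open>\<cong>\<close>.

  Partners are found by initial lifting. The assumption reads \<open>X(FA,GC) = D(KA,RHC)\<close>, that is,
  \<open>GC\<close> matches \<open>RHC\<close>. An object \<open>x\<close> is initial for all its maps to objects \<open>GC\<close>, so the initial
  lifting in \<open>D\<close> of these maps, read as maps to \<open>RHC\<close>, has the same probes as \<open>x\<close>; being initial for
  maps to values of \<open>R\<close>, it lies in \<open>Fix(RL)\<close>. Conversely an object \<open>Y\<close> of \<open>Fix(RL)\<close> is initial for its
  maps to objects \<open>RHC\<close>, because \<open>LY\<close> is initial for its maps to objects \<open>HC\<close>, and these maps are
  lifted in \<open>X\<close> as maps to \<open>GC\<close>.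
\<close>

section \<open>Morphisms along the order of objects\<close>

context concrete_category
begin

lemma mor_obj_le_right:
  assumes "X \<in> obj E" "Y \<in> obj E" "Z \<in> obj E"
    and f: "f \<in> mor E X Y" and le: "obj_le B E Y Z"
  shows "f \<in> mor E X Z"
proof -
  have "f \<in> Hom B (und E X) (und E Y)"
    using mor_Hom f assms(1,2) by blast
  then have "Idt B (und E Y) \<cdot> f = f"
    by (rule Idt_Cmp)
  then show ?thesis
    using mor_Cmp[OF assms(1-3) f] le by (metis obj_le_def)
qed

lemma mor_obj_le_left:
  assumes "X \<in> obj E" "Y \<in> obj E" "Z \<in> obj E"
    and le: "obj_le B E X Y" and f: "f \<in> mor E Y Z"
  shows "f \<in> mor E X Z"
proof -
  have "f \<in> Hom B (und E X) (und E Z)"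
    using mor_Hom f assms(2,3) le unfolding obj_le_def by auto
  then have "f \<cdot> Idt B (und E X) = f"
    by (rule Cmp_Idt)
  then show ?thesis
    using mor_Cmp[OF assms(1-3) _ f] le by (metis obj_le_def)
qed

lemma mor_obj_cong:
  assumes "X \<in> obj E" "X' \<in> obj E" "Y \<in> obj E" "Y' \<in> obj E"
    and "obj_cong B E X X'" "obj_cong B E Y Y'"
  shows "mor E X Y = mor E X' Y'"
proof (intro equalityI subsetI)
  have le: "obj_le B E X X'" "obj_le B E X' X" "obj_le B E Y Y'" "obj_le B E Y' Y"
    using assms(5,6) by (simp_all add: obj_cong_def)
  show "f \<in> mor E X' Y'" if "f \<in> mor E X Y" for f
    by (rule mor_obj_le_left[OF assms(2,1,4) le(2) mor_obj_le_right[OF assms(1,3,4) that le(3)]])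
  show "f \<in> mor E X Y" if "f \<in> mor E X' Y'" for f
    by (rule mor_obj_le_left[OF assms(1,2,3) le(1) mor_obj_le_right[OF assms(2,4,3) that le(4)]])
qed

lemma obj_cong_refl: "X \<in> obj E \<Longrightarrow> obj_cong B E X X"
  by (simp add: obj_cong_def obj_le_def mor_Idt)

lemma obj_cong_sym: "obj_cong B E X Y \<Longrightarrow> obj_cong B E Y X"
  by (auto simp: obj_cong_def)

lemma obj_le_trans:
  assumes "X \<in> obj E" "Y \<in> obj E" "Z \<in> obj E"
    and XY: "obj_le B E X Y" and YZ: "obj_le B E Y Z"
  shows "obj_le B E X Z"
proof -
  have "Idt B (und E X) \<in> mor E X Z"
    by (rule mor_obj_le_right[OF assms(1-3) _ YZ]) (use XY in \<open>unfold obj_le_def, blast\<close>)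
  moreover have "und E X = und E Z"
    using XY YZ by (simp add: obj_le_def)
  ultimately show ?thesis
    by (simp add: obj_le_def)
qed

lemma obj_cong_trans:
  assumes "X \<in> obj E" "Y \<in> obj E" "Z \<in> obj E"
    and "obj_cong B E X Y" "obj_cong B E Y Z"
  shows "obj_cong B E X Z"
  using assms(4,5) obj_le_trans[OF assms(1-3)] obj_le_trans[OF assms(3,2,1)]
  by (simp add: obj_cong_def)

end

lemma concrete_functor_obj_cong:
  assumes "concrete_functor D E F" "X \<in> obj D" "Y \<in> obj D" "obj_cong B D X Y"
  shows "obj_cong B E (F X) (F Y)"
proof -
  have F: "und E (F X) = und D X" "und E (F Y) = und D Y"
    "mor D X Y \<subseteq> mor E (F X) (F Y)" "mor D Y X \<subseteq> mor E (F Y) (F X)"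
    using assms(1-3) by (simp_all add: concrete_functor_def)
  show ?thesis
    using assms(4) F(3,4) unfolding obj_cong_def obj_le_def F(1,2) by blast
qed

section \<open>Density\<close>

context concrete_category
begin

text \<open>
  The sink that witnesses density at \<open>Y\<close> consists of some maps \<open>F X \<rightarrow> Y\<close>. Adding all other such maps
  keeps it final, so the choice of the witness disappears from the characterisation.
\<close>

lemma mor_iff_finally_dense:
  fixes D :: "('p, 'b, 'm) concrete"
  assumes dense: "finally_dense B D E F" and F: "concrete_functor D E F"
    and Y: "Y \<in> obj E" and Z: "Z \<in> obj E"
  shows "g \<in> mor E Y Z \<longleftrightarrow>
    g \<in> Hom B (und E Y) (und E Z) \<and> (\<forall>X\<in>obj D. \<forall>f\<in>mor E (F X) Y. g \<cdot> f \<in> mor E (F X) Z)"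
    (is "_ \<longleftrightarrow> ?R")
proof
  assume "g \<in> mor E Y Z"
  then show ?R
    using mor_Hom mor_Cmp F Y Z unfolding concrete_functor_def by blast
next
  assume R: ?R
  obtain I :: "('p \<times> 'm) set" and X f where
    X: "\<forall>i\<in>I. X i \<in> obj D" and sink: "final_sink B E Y I (\<lambda>i. F (X i)) f"
    using dense Y unfolding finally_dense_def by blast
  have "\<forall>i\<in>I. f i \<in> mor E (F (X i)) Y"
    and final: "\<And>g. \<lbrakk>g \<in> Hom B (und E Y) (und E Z); \<forall>i\<in>I. g \<cdot> f i \<in> mor E (F (X i)) Z\<rbrakk>
      \<Longrightarrow> g \<in> mor E Y Z"
    using sink Z by (simp_all add: final_sink_def)
  then have "\<forall>i\<in>I. g \<cdot> f i \<in> mor E (F (X i)) Z"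
    using R X by simp
  then show "g \<in> mor E Y Z"
    using R final by simp
qed

lemma mor_iff_initially_dense:
  fixes D :: "('p, 'b, 'm) concrete"
  assumes dense: "initially_dense B D E F" and F: "concrete_functor D E F"
    and Y: "Y \<in> obj E" and Z: "Z \<in> obj E"
  shows "f \<in> mor E Z Y \<longleftrightarrow>
    f \<in> Hom B (und E Z) (und E Y) \<and> (\<forall>X\<in>obj D. \<forall>g\<in>mor E Y (F X). g \<cdot> f \<in> mor E Z (F X))"
    (is "_ \<longleftrightarrow> ?R")
proof
  assume "f \<in> mor E Z Y"
  then show ?R
    using mor_Hom mor_Cmp F Y Z unfolding concrete_functor_def by blast
next
  assume R: ?R
  obtain I :: "('p \<times> 'm) set" and X g where
    X: "\<forall>i\<in>I. X i \<in> obj D" and source: "initial_source B E Y I (\<lambda>i. F (X i)) g"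
    using dense Y unfolding initially_dense_def by blast
  have "\<forall>i\<in>I. g i \<in> mor E Y (F (X i))"
    and initial: "\<And>f. \<lbrakk>f \<in> Hom B (und E Z) (und E Y); \<forall>i\<in>I. g i \<cdot> f \<in> mor E Z (F (X i))\<rbrakk>
      \<Longrightarrow> f \<in> mor E Z Y"
    using source Z by (simp_all add: initial_source_def)
  then have "\<forall>i\<in>I. g i \<cdot> f \<in> mor E Z (F (X i))"
    using R X by simp
  then show "f \<in> mor E Z Y"
    using R initial by simp
qed

lemma mor_iff_initial_source:
  assumes source: "initial_source B E Y I X g" and Z: "Z \<in> obj E"
  shows "f \<in> mor E Z Y \<longleftrightarrow>
    f \<in> Hom B (und E Z) (und E Y) \<and> (\<forall>i\<in>I. g i \<cdot> f \<in> mor E Z (X i))"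
proof -
  have Y: "Y \<in> obj E" and X: "\<forall>i\<in>I. X i \<in> obj E \<and> g i \<in> mor E Y (X i)"
    using source by (simp_all add: initial_source_def)
  have "f \<in> Hom B (und E Z) (und E Y) \<and> (\<forall>i\<in>I. g i \<cdot> f \<in> mor E Z (X i))" if "f \<in> mor E Z Y"
    using that mor_Hom[OF Z Y] mor_Cmp[OF Z Y] X by blast
  moreover have "f \<in> mor E Z Y"
    if "f \<in> Hom B (und E Z) (und E Y)" "\<forall>i\<in>I. g i \<cdot> f \<in> mor E Z (X i)"
    using that source Z by (simp add: initial_source_def)
  ultimately show ?thesis
    by blast
qed

text \<open>
  If \<open>F S \<cong> Y\<close>, then the identity map between them is both a final sink and an initial source.
\<close>

lemma finally_dense_if_surj_cong:
  fixes D :: "('p, 'b, 'm) concrete"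
  assumes F: "concrete_functor D E F"
    and surj: "\<And>Y. Y \<in> obj E \<Longrightarrow> \<exists>S\<in>obj D. obj_cong B E (F S) Y"
  shows "finally_dense B D E F"
proof (rule finally_denseI_any_index)
  fix Y assume Y: "Y \<in> obj E"
  then obtain S where S: "S \<in> obj D" and cong: "obj_cong B E (F S) Y"
    using surj by blast
  have FS: "F S \<in> obj E"
    using F S unfolding concrete_functor_def by blast
  have Idt: "Idt B (und E Y) \<in> mor E (F S) Y"
    using cong unfolding obj_cong_def obj_le_def by metis
  have "g \<in> mor E Y Z"
    if "Z \<in> obj E" "g \<in> Hom B (und E Y) (und E Z)" "g \<cdot> Idt B (und E Y) \<in> mor E (F S) Z" for Z g
    using that Cmp_Idt[OF that(2)] mor_obj_cong[OF FS Y that(1,1) cong obj_cong_refl[OF that(1)]]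
    by simp
  then have "final_sink B E Y {()} (\<lambda>_. F S) (\<lambda>_. Idt B (und E Y))"
    using Y FS Idt unfolding final_sink_def by simp
  then show "\<exists>(I :: unit set) W f. (\<forall>i\<in>I. W i \<in> obj D) \<and> final_sink B E Y I (\<lambda>i. F (W i)) f"
    using S by (intro exI[of _ "{()}"] exI[of _ "\<lambda>_. S"] exI[of _ "\<lambda>_. Idt B (und E Y)"]) simp
qed

lemma initially_dense_if_surj_cong:
  fixes D :: "('p, 'b, 'm) concrete"
  assumes F: "concrete_functor D E F"
    and surj: "\<And>Y. Y \<in> obj E \<Longrightarrow> \<exists>S\<in>obj D. obj_cong B E (F S) Y"
  shows "initially_dense B D E F"
proof (rule initially_denseI_any_index)
  fix Y assume Y: "Y \<in> obj E"
  then obtain S where S: "S \<in> obj D" and cong: "obj_cong B E (F S) Y"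
    using surj by blast
  have FS: "F S \<in> obj E"
    using F S unfolding concrete_functor_def by blast
  have Idt: "Idt B (und E Y) \<in> mor E Y (F S)"
    using cong unfolding obj_cong_def obj_le_def by blast
  have "f \<in> mor E Z Y"
    if "Z \<in> obj E" "f \<in> Hom B (und E Z) (und E Y)" "Idt B (und E Y) \<cdot> f \<in> mor E Z (F S)" for Z f
    using that Idt_Cmp[OF that(2)] mor_obj_cong[OF that(1,1) FS Y obj_cong_refl[OF that(1)] cong]
    by simp
  then have "initial_source B E Y {()} (\<lambda>_. F S) (\<lambda>_. Idt B (und E Y))"
    using Y FS Idt unfolding initial_source_def by simp
  then show "\<exists>(I :: unit set) W g. (\<forall>i\<in>I. W i \<in> obj D) \<and> initial_source B E Y I (\<lambda>i. F (W i)) g"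
    using S by (intro exI[of _ "{()}"] exI[of _ "\<lambda>_. S"] exI[of _ "\<lambda>_. Idt B (und E Y)"]) simp
qed

end

section \<open>Fixed objects of a Galois correspondence\<close>

locale galois = D: concrete_category B D + E: concrete_category B E
  for B :: "('b, 'm) category" (structure)
    and D :: "('d, 'b, 'm) concrete" and E :: "('e, 'b, 'm) concrete" +
  fixes L :: "'d \<Rightarrow> 'e" and R :: "'e \<Rightarrow> 'd"
  assumes galois: "galois_correspondence B D E L R"
begin

lemma L_functor: "concrete_functor D E L" and R_functor: "concrete_functor E D R"
  using galois by (auto simp: galois_correspondence_def)

lemma L_obj: "Y \<in> obj D \<Longrightarrow> L Y \<in> obj E" and und_L: "Y \<in> obj D \<Longrightarrow> und E (L Y) = und D Y"
  and L_mor: "\<lbrakk>Y \<in> obj D; Z \<in> obj D; f \<in> mor D Y Z\<rbrakk> \<Longrightarrow> f \<in> mor E (L Y) (L Z)"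
  using L_functor by (auto simp: concrete_functor_def)

lemma R_obj: "Y \<in> obj E \<Longrightarrow> R Y \<in> obj D" and und_R: "Y \<in> obj E \<Longrightarrow> und D (R Y) = und E Y"
  and R_mor: "\<lbrakk>Y \<in> obj E; Z \<in> obj E; f \<in> mor E Y Z\<rbrakk> \<Longrightarrow> f \<in> mor D (R Y) (R Z)"
  using R_functor by (auto simp: concrete_functor_def)

lemma unit_le: "Y \<in> obj D \<Longrightarrow> obj_le B D Y (R (L Y))"
  and counit_le: "Z \<in> obj E \<Longrightarrow> obj_le B E (L (R Z)) Z"
  using galois by (auto simp: galois_correspondence_def functor_le_def)

lemma mor_L_eq_mor_R:
  assumes Y: "Y \<in> obj D" and Z: "Z \<in> obj E"
  shows "mor E (L Y) Z = mor D Y (R Z)"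
proof (intro equalityI subsetI)
  fix f assume "f \<in> mor E (L Y) Z"
  then have "f \<in> mor D (R (L Y)) (R Z)"
    using Y Z L_obj R_mor by blast
  then show "f \<in> mor D Y (R Z)"
    using D.mor_obj_le_left unit_le Y Z L_obj R_obj by blast
next
  fix f assume "f \<in> mor D Y (R Z)"
  then have "f \<in> mor E (L Y) (L (R Z))"
    using Y Z R_obj L_mor by blast
  then show "f \<in> mor E (L Y) Z"
    using E.mor_obj_le_right counit_le Y Z L_obj R_obj by blast
qed

lemma Fix_simps [simp]: "und (Fix B D T) = und D" "mor (Fix B D T) = mor D"
  by (simp_all add: Fix_def)

lemma obj_cong_Fix [simp]: "obj_cong B (Fix B D T) Y Z \<longleftrightarrow> obj_cong B D Y Z"
  by (simp add: obj_cong_def obj_le_def)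

lemma Fix_iff: "Y \<in> obj (Fix B D (R \<circ> L)) \<longleftrightarrow> Y \<in> obj D \<and> obj_cong B D (R (L Y)) Y"
  by (simp add: Fix_def)

text \<open>
  The maps \<open>g\<close> in the source are also morphisms out of \<open>RLY\<close>, by adjunction and functoriality of \<open>R\<close>;
  so initiality makes the identity a morphism \<open>RLY \<rightarrow> Y\<close>.
\<close>

lemma Fix_if_initial_source:
  assumes source: "initial_source B D Y I (\<lambda>i. R (Z i)) g" and Z: "\<And>i. i \<in> I \<Longrightarrow> Z i \<in> obj E"
  shows "Y \<in> obj (Fix B D (R \<circ> L))"
proof -
  have Y: "Y \<in> obj D" and g: "\<And>i. i \<in> I \<Longrightarrow> g i \<in> mor D Y (R (Z i))"
    using source unfolding initial_source_def by blast+
  have RLY: "R (L Y) \<in> obj D" and und: "und D (R (L Y)) = und D Y"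
    using Y by (simp_all add: L_obj R_obj und_L und_R)
  have "g i \<cdot> Idt B (und D Y) \<in> mor D (R (L Y)) (R (Z i))" if i: "i \<in> I" for i
  proof -
    have "g i \<in> mor E (L Y) (Z i)"
      using g[OF i] mor_L_eq_mor_R[OF Y Z[OF i]] by blast
    then have "g i \<in> mor D (R (L Y)) (R (Z i))"
      using R_mor L_obj[OF Y] Z[OF i] by blast
    moreover have "g i \<in> Hom B (und D Y) (und D (R (Z i)))"
      using g[OF i] D.mor_Hom[OF Y R_obj[OF Z[OF i]]] by blast
    ultimately show ?thesis
      by (simp add: D.Cmp_Idt)
  qed
  moreover have "Idt B (und D Y) \<in> Hom B (und D (R (L Y))) (und D Y)"
    using D.Idt_Hom[OF D.und_Ob[OF Y]] und by simp
  ultimately have "Idt B (und D Y) \<in> mor D (R (L Y)) Y"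
    using D.mor_iff_initial_source[OF source RLY] by blast
  then show ?thesis
    using unit_le[OF Y] Y und by (simp add: Fix_iff obj_cong_def obj_le_def)
qed

lemma R_Fix:
  assumes Y: "Y \<in> obj E"
  shows "R Y \<in> obj (Fix B D (R \<circ> L))"
proof -
  have "obj_le B D (R (L (R Y))) (R Y)"
    using counit_le[OF Y] R_mor Y
    by (auto simp: obj_le_def R_obj L_obj und_L und_R)
  then show ?thesis
    using unit_le[OF R_obj[OF Y]] Y by (simp add: Fix_iff obj_cong_def R_obj)
qed

lemma R_functor_Fix: "concrete_functor E (Fix B D (R \<circ> L)) R"
  using R_functor R_Fix by (simp add: concrete_functor_def)

lemma RL_functor_Fix: "concrete_functor D (Fix B D (R \<circ> L)) (R \<circ> L)"
  unfolding concrete_functor_def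
  by (auto simp: R_Fix L_obj und_L und_R intro!: R_mor L_mor)

text \<open>
  For \<open>Y \<cong> RLY\<close>, morphisms into \<open>Y\<close> correspond under the adjunction to morphisms into \<open>LY\<close>, which
  maps to the objects \<open>HC\<close> detect.
\<close>

lemma mor_Fix_iff_initially_dense:
  assumes dense: "initially_dense B C E H" and H: "concrete_functor C E H"
    and Y: "Y \<in> obj (Fix B D (R \<circ> L))" and Z: "Z \<in> obj D"
  shows "f \<in> mor D Z Y \<longleftrightarrow> f \<in> Hom B (und D Z) (und D Y) \<and>
    (\<forall>c\<in>obj C. \<forall>g\<in>mor D Y (R (H c)). g \<cdot> f \<in> mor D Z (R (H c)))"
proof -
  have YD: "Y \<in> obj D" and cong: "obj_cong B D (R (L Y)) Y"
    using Y by (simp_all add: Fix_iff)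
  have HC: "c \<in> obj C \<Longrightarrow> H c \<in> obj E" for c
    using H by (simp add: concrete_functor_def)
  have LY: "L Y \<in> obj E"
    using YD by (rule L_obj)
  have "mor D Z Y = mor D Z (R (L Y))"
    using D.mor_obj_cong[OF Z Z R_obj[OF LY] YD D.obj_cong_refl[OF Z] cong] by simp
  also have "\<dots> = mor E (L Z) (L Y)"
    using mor_L_eq_mor_R[OF Z LY] by simp
  finally show ?thesis
    using E.mor_iff_initially_dense[OF dense H LY L_obj[OF Z], of f] YD Z
    by (simp add: und_L mor_L_eq_mor_R HC)
qed

end

section \<open>From an equivalence to dense data\<close>

text \<open>
  A concrete functor with a concrete left inverse up to \<open>\<cong>\<close> is full, since \<open>P'\<close> carries a morphism
  \<open>PX \<rightarrow> PY\<close> to the same map \<open>P'PX \<rightarrow> P'PY\<close>.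
\<close>

lemma (in concrete_category) mor_eq_if_cong_id:
  assumes P: "concrete_functor E E' P" and P': "concrete_functor E' E P'"
    and cong: "functor_cong B E E (P' \<circ> P) id"
    and X: "X \<in> obj E" and Y: "Y \<in> obj E"
  shows "mor E' (P X) (P Y) = mor E X Y"
proof
  show "mor E X Y \<subseteq> mor E' (P X) (P Y)"
    using P X Y by (simp add: concrete_functor_def)
  have PX: "P X \<in> obj E'" "P Y \<in> obj E'"
    using P X Y by (simp_all add: concrete_functor_def)
  then have "mor E' (P X) (P Y) \<subseteq> mor E (P' (P X)) (P' (P Y))"
    using P' by (simp add: concrete_functor_def)
  also have "\<dots> = mor E X Y"
    using PX P' X Y cong by (intro mor_obj_cong) (simp_all add: concrete_functor_def functor_cong_def)
  finally show "mor E' (P X) (P Y) \<subseteq> mor E X Y" .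
qed

lemma concrete_functor_comp:
  assumes F: "concrete_functor C D F" and G: "concrete_functor D E G"
  shows "concrete_functor C E (G \<circ> F)"
proof -
  have "mor C Y Z \<subseteq> mor E (G (F Y)) (G (F Z))" if "Y \<in> obj C" "Z \<in> obj C" for Y Z
  proof (rule subset_trans)
    show "mor C Y Z \<subseteq> mor D (F Y) (F Z)"
      using F that by (simp add: concrete_functor_def)
    show "mor D (F Y) (F Z) \<subseteq> mor E (G (F Y)) (G (F Z))"
      using F G that by (simp add: concrete_functor_def)
  qed
  then show ?thesis
    using F G by (simp add: concrete_functor_def)
qed

lemma (in galois) Fix_concrete_category: "concrete_category B (Fix B D (R \<circ> L))"
proof
  fix Y Z W f g
  show "Y \<in> obj (Fix B D (R \<circ> L)) \<Longrightarrow> und (Fix B D (R \<circ> L)) Y \<in> Ob B"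
    by (simp add: Fix_iff D.und_Ob)
  show "Y \<in> obj (Fix B D (R \<circ> L)) \<Longrightarrow> Z \<in> obj (Fix B D (R \<circ> L)) \<Longrightarrow>
      mor (Fix B D (R \<circ> L)) Y Z \<subseteq> Hom B (und (Fix B D (R \<circ> L)) Y) (und (Fix B D (R \<circ> L)) Z)"
    by (simp add: Fix_iff D.mor_Hom)
  show "Y \<in> obj (Fix B D (R \<circ> L)) \<Longrightarrow> Idt B (und (Fix B D (R \<circ> L)) Y) \<in> mor (Fix B D (R \<circ> L)) Y Y"
    by (simp add: Fix_iff D.mor_Idt)
  show "Y \<in> obj (Fix B D (R \<circ> L)) \<Longrightarrow> Z \<in> obj (Fix B D (R \<circ> L)) \<Longrightarrow> W \<in> obj (Fix B D (R \<circ> L)) \<Longrightarrow>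
      f \<in> mor (Fix B D (R \<circ> L)) Y Z \<Longrightarrow> g \<in> mor (Fix B D (R \<circ> L)) Z W \<Longrightarrow>
      g \<cdot> f \<in> mor (Fix B D (R \<circ> L)) Y W"
    using D.mor_Cmp[of Y Z W f g] by (simp add: Fix_iff)
qed

lemma (in galois) dense_data_if_concretely_equivalent:
  assumes X: "concrete_category B X" and equiv: "concretely_equivalent B X (Fix B D (R \<circ> L))"
  shows "\<exists>F G. dense_data B D E L X D E F id G id"
proof -
  let ?Fix = "Fix B D (R \<circ> L)"
  interpret X: concrete_category B X
    by (rule X)
  interpret Fix: concrete_category B ?Fix
    by (rule Fix_concrete_category)
  obtain P P' where P: "concrete_functor X ?Fix P" and P': "concrete_functor ?Fix X P'"
    and XX: "functor_cong B X X id (P' \<circ> P)" and FF: "functor_cong B ?Fix ?Fix (P \<circ> P') id"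
    using equiv unfolding concretely_equivalent_def by blast
  define F where "F = P' \<circ> (R \<circ> L)"
  define G where "G = P' \<circ> R"
  have F: "concrete_functor D X F" and G: "concrete_functor E X G"
    unfolding F_def G_def
    using RL_functor_Fix R_functor_Fix P' by (blast intro: concrete_functor_comp)+
  have D_id: "concrete_functor D D id" and E_id: "concrete_functor E E id"
    by (simp_all add: concrete_functor_def)
  have PFix: "P x \<in> obj ?Fix" if "x \<in> obj X" for x
    using that P by (simp add: concrete_functor_def)
  have RLP: "obj_cong B X (F (P x)) x" if x: "x \<in> obj X" for x
  proof -
    have PD: "P x \<in> obj D" and RLPx: "R (L (P x)) \<in> obj ?Fix"
      using PFix[OF x] by (simp_all add: Fix_iff[of "P x"] R_Fix L_obj)
    have "obj_cong B ?Fix (R (L (P x))) (P x)"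
      using PFix[OF x] by (simp add: Fix_iff)
    then have "obj_cong B X (P' (R (L (P x)))) (P' (P x))"
      using concrete_functor_obj_cong[OF P' RLPx PFix[OF x]] by blast
    moreover have "obj_cong B X (P' (P x)) x"
      using XX x X.obj_cong_sym by (simp add: functor_cong_def)
    ultimately show ?thesis
      using X.obj_cong_trans[of "P' (R (L (P x)))" "P' (P x)" x] P' RLPx PFix[OF x] x
      by (simp add: F_def concrete_functor_def)
  qed
  have F_dense: "finally_dense B D X F"
  proof (rule X.finally_dense_if_surj_cong[OF F])
    fix x assume x: "x \<in> obj X"
    then show "\<exists>Y\<in>obj D. obj_cong B X (F Y) x"
      using RLP PFix Fix_iff by blast
  qed
  have G_dense: "initially_dense B E X G"
  proof (rule X.initially_dense_if_surj_cong[OF G])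
    fix x assume x: "x \<in> obj X"
    have "obj_cong B X (G (L (P x))) x"
      using RLP[OF x] by (simp add: F_def G_def)
    then show "\<exists>Y\<in>obj E. obj_cong B X (G Y) x"
      using PFix[OF x] Fix_iff L_obj by blast
  qed
  have "mor E (L Y) Z = mor X (F Y) (G Z)" if Y: "Y \<in> obj D" and Z: "Z \<in> obj E" for Y Z
  proof -
    have RLY: "R (L Y) \<in> obj ?Fix" and RZ: "R Z \<in> obj ?Fix"
      using Y Z by (simp_all add: R_Fix L_obj)
    have "mor E (L Y) Z \<subseteq> mor D (R (L Y)) (R Z)"
      using R_mor L_obj Y Z by blast
    moreover have "mor D (R (L Y)) (R Z) \<subseteq> mor D Y (R Z)"
      using D.mor_obj_le_left[OF Y R_obj[OF L_obj[OF Y]] R_obj[OF Z] unit_le[OF Y]] by blast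
    ultimately have "mor E (L Y) Z = mor D (R (L Y)) (R Z)"
      using mor_L_eq_mor_R[OF Y Z] by blast
    also have "\<dots> = mor X (P' (R (L Y))) (P' (R Z))"
      using Fix.mor_eq_if_cong_id[OF P' P FF RLY RZ] by simp
    finally show ?thesis
      by (simp add: F_def G_def)
  qed
  moreover have "finally_dense B D D id"
    by (rule D.finally_dense_if_surj_cong[OF D_id]) (auto intro: D.obj_cong_refl)
  moreover have "initially_dense B E E id"
    by (rule E.initially_dense_if_surj_cong[OF E_id]) (auto intro: E.obj_cong_refl)
  ultimately have "dense_data B D E L X D E F id G id"
    unfolding dense_data_def
    using D.concrete_category_axioms E.concrete_category_axioms F G F_dense G_dense D_id E_id
    by simp
  then show ?thesis
    by blast
qed

section \<open>From dense data to an equivalence\<close>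

locale galois_dense_data = galois B D E L R + X: concrete_category B X
  for B :: "('b, 'm) category" (structure)
    and D :: "('d, 'b, 'm) concrete" and E :: "('e, 'b, 'm) concrete"
    and L :: "'d \<Rightarrow> 'e" and R :: "'e \<Rightarrow> 'd" and X :: "('x, 'b, 'm) concrete" +
  fixes A :: "('a, 'b, 'm) concrete" and C :: "('c, 'b, 'm) concrete"
    and F :: "'a \<Rightarrow> 'x" and K :: "'a \<Rightarrow> 'd" and G :: "'c \<Rightarrow> 'x" and H :: "'c \<Rightarrow> 'e"
  assumes data: "dense_data B D E L X A C F K G H"
begin

lemma F: "concrete_functor A X F" "finally_dense B A X F"
  and K: "concrete_functor A D K" "finally_dense B A D K"
  and G: "concrete_functor C X G" "initially_dense B C X G"
  and H: "concrete_functor C E H" "initially_dense B C E H"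
  using data by (simp_all add: dense_data_def)

lemma F_obj: "a \<in> obj A \<Longrightarrow> F a \<in> obj X" and und_F: "a \<in> obj A \<Longrightarrow> und X (F a) = und A a"
  and K_obj: "a \<in> obj A \<Longrightarrow> K a \<in> obj D" and und_K: "a \<in> obj A \<Longrightarrow> und D (K a) = und A a"
  and G_obj: "c \<in> obj C \<Longrightarrow> G c \<in> obj X" and und_G: "c \<in> obj C \<Longrightarrow> und X (G c) = und C c"
  and H_obj: "c \<in> obj C \<Longrightarrow> H c \<in> obj E" and und_H: "c \<in> obj C \<Longrightarrow> und E (H c) = und C c"
  using F K G H by (simp_all add: concrete_functor_def)

lemma mor_FG: "\<lbrakk>a \<in> obj A; c \<in> obj C\<rbrakk> \<Longrightarrow> mor X (F a) (G c) = mor D (K a) (R (H c))"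
  using data mor_L_eq_mor_R[OF K_obj H_obj] by (simp add: dense_data_def)

definition matching :: "'x \<Rightarrow> 'd \<Rightarrow> bool" where
  "matching x Y \<longleftrightarrow>
     und X x = und D Y \<and> (\<forall>a\<in>obj A. mor X (F a) x = mor D (K a) Y)"

text \<open>
  Final density of \<open>F\<close> and of \<open>K\<close> describes both hom-sets by the same condition on probes.
\<close>

lemma mor_eq_if_matching:
  assumes "x \<in> obj X" "y \<in> obj X" "Y \<in> obj D" "Z \<in> obj D"
    and "matching x Y" "matching y Z"
  shows "mor X x y = mor D Y Z"
  using assms X.mor_iff_finally_dense[OF F(2,1), of x y] D.mor_iff_finally_dense[OF K(2,1), of Y Z]
  by (auto simp: matching_def)

text \<open>
  A map \<open>f\<close> is a probe of \<open>x\<close> iff all composites \<open>g \<cdot> f\<close> with maps \<open>g : x \<rightarrow> GC\<close> are morphisms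
  \<open>FA \<rightarrow> GC\<close>, equivalently \<open>KA \<rightarrow> RHC\<close>. The second condition describes the
  probes of the initial lifting \<open>Y\<close> of the maps \<open>g\<close>.
\<close>

lemma ex_Fix_matching:
  assumes D: "topological_category B D" and x: "x \<in> obj X"
  shows "\<exists>Y\<in>obj (Fix B D (R \<circ> L)). matching x Y"
proof -
  let ?I = "{(c, g). c \<in> obj C \<and> g \<in> mor X x (G c)}"
  have "\<forall>i\<in>?I. R (H (fst i)) \<in> obj D \<and> snd i \<in> Hom B (und X x) (und D (R (H (fst i))))"
    using X.mor_Hom[OF x G_obj] by (auto simp: R_obj H_obj und_R und_H und_G)
  then obtain Y where und: "und D Y = und X x"
    and source: "initial_source B D Y ?I (\<lambda>i. R (H (fst i))) snd"
    using topological_category.initial_lifting_any_index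
        [OF D X.und_Ob[OF x], of ?I "\<lambda>i. R (H (fst i))" snd] by blast
  have "f \<in> mor X (F a) x \<longleftrightarrow> f \<in> mor D (K a) Y" if a: "a \<in> obj A" for a f
    using X.mor_iff_initially_dense[OF G(2,1) x F_obj[OF a], of f]
      D.mor_iff_initial_source[OF source K_obj[OF a], of f] a
    by (auto simp: und und_F und_K mor_FG)
  then have "matching x Y"
    using und by (auto simp: matching_def)
  moreover have "Y \<in> obj (Fix B D (R \<circ> L))"
    using source by (rule Fix_if_initial_source) (auto simp: H_obj)
  ultimately show ?thesis
    by blast
qed

text \<open>
  The same comparison read backwards; that \<open>Y\<close> is fixed is what makes its maps to the objects
  \<open>RHC\<close> detect the probes of \<open>Y\<close>.
\<close>

lemma ex_matching_Fix:
  assumes X: "topological_category B X" and Y: "Y \<in> obj (Fix B D (R \<circ> L))"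
  shows "\<exists>x\<in>obj X. matching x Y"
proof -
  have YD: "Y \<in> obj D"
    using Y by (simp add: Fix_iff)
  let ?I = "{(c, g). c \<in> obj C \<and> g \<in> mor D Y (R (H c))}"
  have "\<forall>i\<in>?I. G (fst i) \<in> obj X \<and> snd i \<in> Hom B (und D Y) (und X (G (fst i)))"
    using D.mor_Hom[OF YD R_obj[OF H_obj]] by (auto simp: G_obj H_obj und_R und_H und_G)
  then obtain x where und: "und X x = und D Y"
    and source: "initial_source B X x ?I (\<lambda>i. G (fst i)) snd"
    using topological_category.initial_lifting_any_index
        [OF X D.und_Ob[OF YD], of ?I "\<lambda>i. G (fst i)" snd] by blast
  have "f \<in> mor X (F a) x \<longleftrightarrow> f \<in> mor D (K a) Y" if a: "a \<in> obj A" for a f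
    using mor_Fix_iff_initially_dense[OF H(2,1) Y K_obj[OF a], of f]
      X.mor_iff_initial_source[OF source F_obj[OF a], of f] a
    by (auto simp: und und_F und_K mor_FG)
  then have "matching x Y"
    using und by (auto simp: matching_def)
  then show ?thesis
    using source unfolding initial_source_def by blast
qed

lemma concretely_equivalent_Fix:
  assumes D: "topological_category B D" and X: "topological_category B X"
  shows "concretely_equivalent B X (Fix B D (R \<circ> L))"
proof -
  let ?Fix = "Fix B D (R \<circ> L)"
  obtain P where P: "\<And>x. x \<in> obj X \<Longrightarrow> P x \<in> obj ?Fix" "\<And>x. x \<in> obj X \<Longrightarrow> matching x (P x)"
    using ex_Fix_matching[OF D] by metis
  obtain P' where P': "\<And>Y. Y \<in> obj ?Fix \<Longrightarrow> P' Y \<in> obj X" "\<And>Y. Y \<in> obj ?Fix \<Longrightarrow> matching (P' Y) Y"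
    using ex_matching_Fix[OF X] by metis
  have FixD: "Y \<in> obj D" if "Y \<in> obj ?Fix" for Y
    using that by (simp add: Fix_iff)
  have und_P: "und D (P x) = und X x" if "x \<in> obj X" for x
    using P(2)[OF that] by (simp add: matching_def)
  have und_P': "und X (P' Y) = und D Y" if "Y \<in> obj ?Fix" for Y
    using P'(2)[OF that] by (simp add: matching_def)
  have "mor X x y = mor D (P x) (P y)" if "x \<in> obj X" "y \<in> obj X" for x y
    by (rule mor_eq_if_matching) (simp_all add: that P FixD)
  then have "concrete_functor X ?Fix P"
    by (simp add: concrete_functor_def P und_P)
  moreover have "mor X (P' Y) (P' Z) = mor D Y Z" if "Y \<in> obj ?Fix" "Z \<in> obj ?Fix" for Y Z
    by (rule mor_eq_if_matching) (simp_all add: that P' FixD)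
  then have "concrete_functor ?Fix X P'"
    by (simp add: concrete_functor_def P' und_P')
  moreover have "obj_cong B X x (P' (P x))" if x: "x \<in> obj X" for x
  proof -
    note Px = P[OF x] and P'Px = P'[OF P(1)[OF x]]
    \<comment> \<open>Both \<open>x\<close> and \<open>P' (P x)\<close> match \<open>P x\<close>, so either hom-set between them contains the identity.\<close>
    have "mor X x (P' (P x)) = mor D (P x) (P x)"
      by (rule mor_eq_if_matching[OF x P'Px(1) FixD FixD Px(2) P'Px(2)]) (fact Px(1))+
    moreover have "mor X (P' (P x)) x = mor D (P x) (P x)"
      by (rule mor_eq_if_matching[OF P'Px(1) x FixD FixD P'Px(2) Px(2)]) (fact Px(1))+
    ultimately show ?thesis
      using D.mor_Idt[OF FixD[OF Px(1)]] by (simp add: obj_cong_def obj_le_def und_P x und_P' Px(1))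
  qed
  moreover have "obj_cong B D (P (P' Y)) Y" if Y: "Y \<in> obj ?Fix" for Y
  proof -
    note P'Y = P'[OF Y] and PP'Y = P[OF P'(1)[OF Y]]
    have "mor X (P' Y) (P' Y) = mor D (P (P' Y)) Y"
      by (rule mor_eq_if_matching[OF P'Y(1,1) FixD FixD PP'Y(2) P'Y(2)]) (fact PP'Y(1) Y)+
    moreover have "mor X (P' Y) (P' Y) = mor D Y (P (P' Y))"
      by (rule mor_eq_if_matching[OF P'Y(1,1) FixD FixD P'Y(2) PP'Y(2)]) (fact PP'Y(1) Y)+
    ultimately show ?thesis
      using X.mor_Idt[OF P'Y(1)] by (simp add: obj_cong_def obj_le_def und_P und_P' Y P'Y(1))
  qed
  ultimately have "concrete_functor X ?Fix P \<and> concrete_functor ?Fix X P' \<and>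
      functor_cong B X X id (P' \<circ> P) \<and> functor_cong B ?Fix ?Fix (P \<circ> P') id"
    by (simp add: functor_cong_def)
  then show ?thesis
    unfolding concretely_equivalent_def by blast
qed

end

lemma (in galois) concretely_equivalent_if_dense_data:
  assumes D: "topological_category B D" and X: "topological_category B X"
    and data: "dense_data B D E L X A C F K G H"
  shows "concretely_equivalent B X (Fix B D (R \<circ> L))"
proof -
  interpret X: topological_category B X
    by (rule X)
  interpret galois_dense_data B D E L R X A C F K G H
    by unfold_locales (rule data)
  show ?thesis
    by (rule concretely_equivalent_Fix[OF D X])
qed

section \<open>Characterisation of the category of fixed objects\<close>

(* HOL cannot quantify existentially over the object types of A and C. The equivalence is stated
   with the object types of D and E, which is the strongest form of "only if"; the second conjunct
   is the "if" direction for A and C with arbitrary object types 'a and 'c. *)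
theorem theorem7p6:
  fixes B :: "('b, 'm) category"
    and D :: "('d, 'b, 'm) concrete"
    and E :: "('e, 'b, 'm) concrete"
    and X :: "('x, 'b, 'm) concrete"
    and L :: "'d \<Rightarrow> 'e" and R :: "'e \<Rightarrow> 'd"
  assumes "category B"
    and "topological_category B D"
    and "topological_category B E"
    and "galois_correspondence B D E L R"
    and "topological_category B X"
  shows
    "(concretely_equivalent B X (Fix B D (R \<circ> L)) \<longleftrightarrow>
        (\<exists>(A :: ('d, 'b, 'm) concrete) (C :: ('e, 'b, 'm) concrete) F K G H.
           dense_data B D E L X A C F K G H))
     \<and> ((\<exists>(A :: ('a, 'b, 'm) concrete) (C :: ('c, 'b, 'm) concrete) F K G H.
           dense_data B D E L X A C F K G H)
         \<longrightarrow> concretely_equivalent B X (Fix B D (R \<circ> L)))"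
proof -
  have D: "concrete_category B D" and E: "concrete_category B E" and X: "concrete_category B X"
    using assms by (simp_all add: topological_category_def)
  interpret galois B D E L R
    using D E assms(4) by (simp add: galois_def galois_axioms_def)
  show ?thesis
    using dense_data_if_concretely_equivalent[OF X]
      concretely_equivalent_if_dense_data[OF assms(2,5)] by metis
qed

end
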